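(* Let $A\in\mathbb{R}^{M\times N}$, $b\in\mathbb{R}^M$, $\ell\ge1$, $1\le k\le m$. Let $V_{m+\ell}$, $U_{m+\ell+1}$, $B_{m+\ell}$ be computed by $m+\ell$ iterations of standard Golub-Kahan bidiagonalization (GKB). Let $W_{k-1}\in\mathbb{R}^{N\times(k-1)}$ have orthonormal columns with $\mathcal{R}(W_{k-1})\subset\mathcal{R}(V_m)$, let $x^{(1)}\in\mathcal{R}(V_m)$, $x^{(1)}\notin\mathcal{R}(W_{k-1})$, and let $W_k$, $Y_k$, $R_k$, $\widetilde V_\ell$, $\widetilde U_{\ell+1}$, $\widetilde B_\ell$ come from $\ell$ iterations of recycling GKB. Let $T=[T_1\ T_2\ T_c]\in\mathbb{R}^{(m+\ell+1)\times(m+\ell+1)}$ and $Z=[Z_1\ Z_2\ Z_c]\in\mathbb{R}^{(m+\ell)\times(m+\ell)}$ be orthogonal matrices such that $Y_k=U_{m+\ell+1}T_1$, $\widetilde U_{\ell+1}=U_{m+\ell+1}T_2$, $W_k=V_{m+\ell}Z_1$, $\widetilde V_\ell=V_{m+\ell}Z_2$. Then $$[T_1\ T_2\ T_c]^\top B_{m+\ell}\,[Z_1\ Z_2\ Z_c]=\begin{bmatrix}R_k & Y_k^\top A\widetilde V_\ell & T_1^\top B_{m+\ell}Z_c\\ 0&\widetilde B_\ell& T_2^\top B_{m+\ell}Z_c\\ 0&0&T_c^\top B_{m+\ell}Z_c\end{bmatrix}.$$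
   Context: Exact arithmetic and no breakdown are assumed: all normalization scalars $\alpha_j,\beta_j,\widetilde\alpha_j,\widetilde\beta_j$ generated below are nonzero. $\mathcal{R}(\cdot)$ is column space (inclusions not necessarily strict). Orthogonal matrices $T$ and $Z$ with the stated properties exist. Standard GKB: $\beta_1=\|b\|_2$, $u_1=b/\beta_1$, $\alpha_1v_1=A^\top u_1$, and for $j\ge1$, $\beta_{j+1}u_{j+1}=Av_j-\alpha_ju_j$, $\alpha_{j+1}v_{j+1}=A^\top u_{j+1}-\beta_{j+1}v_j$, with the scalars being positive and normalizing the vectors to unit length. $V_n=[v_1\cdots v_n]$, $U_{n+1}=[u_1\cdots u_{n+1}]$ (orthonormal columns), and $B_n\in\mathbb{R}^{(n+1)\times n}$ is lower bidiagonal with $(B_n)_{j,j}=\alpha_j$, $(B_n)_{j+1,j}=\beta_{j+1}$; thus $AV_n=U_{n+1}B_n$. Recycling GKB: given $W_{k-1}$ with orthonormal columns and a vector $x^{(1)}\notin\mathcal{R}(W_{k-1})$, put $\check x^{(1)}=(x^{(1)}-W_{k-1}W_{k-1}^\top x^{(1)})/\|x^{(1)}-W_{k-1}W_{k-1}^\top x^{(1)}\|_2$ and $W_k=[W_{k-1}\ \check x^{(1)}]$. Let $AW_k=Y_kR_k$ be the skinny QR factorization ($Y_k\in\mathbb{R}^{M\times k}$ orthonormal columns, $R_k\in\mathbb{R}^{k\times k}$ upper triangular). Let $\check r^{(1)}=b-A\check x^{(1)}$, $\widetilde b=(I-Y_kY_k^\top)\check r^{(1)}$, $\widetilde\beta_1=\|\widetilde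 b\|_2$, $\widetilde u_1=\widetilde b/\widetilde\beta_1$, $\widetilde\alpha_1\widetilde v_1=A^\top\widetilde u_1$, and for $j=1,\dots,\ell$: $\widetilde\beta_{j+1}\widetilde u_{j+1}=(I-Y_kY_k^\top)A\widetilde v_j-\widetilde\alpha_j\widetilde u_j$, $\widetilde\alpha_{j+1}\widetilde v_{j+1}=A^\top\widetilde u_{j+1}-\widetilde\beta_{j+1}\widetilde v_j$, with positive normalizing scalars. Put $\widetilde V_\ell=[\widetilde v_1\cdots\widetilde v_\ell]$, $\widetilde U_{\ell+1}=[\widetilde u_1\cdots\widetilde u_{\ell+1}]$, and let $\widetilde B_\ell\in\mathbb{R}^{(\ell+1)\times\ell}$ be lower bidiagonal with diagonal $\widetilde\alpha_j$ and subdiagonal $\widetilde\beta_{j+1}$. *)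

theory Defs
  imports Complex_Main "Jordan_Normal_Form.VS_Connect"
begin

text \<open>
  Sequences of scalars and vectors are indexed from 1 as on paper; matrix entries are indexed
  from 0, as always in \<^theory>\<open>Jordan_Normal_Form.Matrix\<close>.
\<close>

definition vnorm :: "real vec \<Rightarrow> real" where
  "vnorm x = sqrt (x \<bullet> x)"

text \<open>Column counterpart of \<^const>\<open>append_rows\<close>.\<close>

definition append_cols :: "'a :: zero mat \<Rightarrow> 'a mat \<Rightarrow> 'a mat" (infixr \<open>@\<^sub>c\<close> 66) where
  "A @\<^sub>c B = four_block_mat A B (0\<^sub>m 0 (dim_col A)) (0\<^sub>m 0 (dim_col B))"

definition cols_upto :: "nat \<Rightarrow> (nat \<Rightarrow> 'a vec) \<Rightarrow> nat \<Rightarrow> 'a mat" where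
  "cols_upto d v n = mat_of_cols d (map v [1..<Suc n])"

definition orthonormal_cols :: "real mat \<Rightarrow> bool" where
  "orthonormal_cols Q \<longleftrightarrow> transpose_mat Q * Q = 1\<^sub>m (dim_col Q)"

text \<open>
  The library's \<^const>\<open>orthogonal_mat\<close> only asks for pairwise orthogonal nonzero columns; here
  the usual meaning is intended.
\<close>

definition real_orthogonal :: "real mat \<Rightarrow> bool" where
  "real_orthogonal Q \<longleftrightarrow>
     square_mat Q \<and> transpose_mat Q * Q = 1\<^sub>m (dim_row Q) \<and> Q * transpose_mat Q = 1\<^sub>m (dim_row Q)"

definition lower_bidiagonal :: "nat \<Rightarrow> (nat \<Rightarrow> real) \<Rightarrow> (nat \<Rightarrow> real) \<Rightarrow> real mat" where
  "lower_bidiagonal n \<alpha> \<beta> = mat (n + 1) n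
     (\<lambda>(i, j). if i = j then \<alpha> (j + 1) else if i = j + 1 then \<beta> (j + 2) else 0)"

text \<open>
  \<open>n\<close> steps of the bidiagonalization recurrence started at \<open>s\<close>, where \<open>C\<close> takes right vectors \<open>v\<close>
  to left vectors \<open>u\<close> and \<open>D\<close> goes back. Absence of breakdown is part of the predicate:
  the scalars are positive and the vectors have unit length. The scalars constrained are those
  entering the (\<open>n + 1\<close>) by \<open>n\<close> bidiagonal matrix; the further pair \<open>\<alpha> (n + 1)\<close>, \<open>v (n + 1)\<close> does
  not occur in the output and is left unconstrained, which keeps e.g. the case admissible where
  \<open>v 1, \<dots>, v n\<close> already span the whole space.
\<close>

definition bidiag_recurrence ::
  "real mat \<Rightarrow> real mat \<Rightarrow> real vec \<Rightarrow> nat \<Rightarrow>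
   (nat \<Rightarrow> real) \<Rightarrow> (nat \<Rightarrow> real) \<Rightarrow> (nat \<Rightarrow> real vec) \<Rightarrow> (nat \<Rightarrow> real vec) \<Rightarrow> bool" where
  "bidiag_recurrence C D s n \<alpha> \<beta> u v \<longleftrightarrow>
     (\<forall>j\<in>{1..n+1}. u j \<in> carrier_vec (dim_row C) \<and> vnorm (u j) = 1 \<and> \<beta> j > 0) \<and>
     (\<forall>j\<in>{1..n}. v j \<in> carrier_vec (dim_col C) \<and> vnorm (v j) = 1 \<and> \<alpha> j > 0) \<and>
     \<beta> 1 = vnorm s \<and> u 1 = (1 / \<beta> 1) \<cdot>\<^sub>v s \<and>
     \<alpha> 1 \<cdot>\<^sub>v v 1 = D *\<^sub>v u 1 \<and>
     (\<forall>j\<in>{1..n}. \<beta> (j + 1) \<cdot>\<^sub>v u (j + 1) = C *\<^sub>v v j - \<alpha> j \<cdot>\<^sub>v u j) \<and>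
     (\<forall>j\<in>{1..<n}. \<alpha> (j + 1) \<cdot>\<^sub>v v (j + 1) = D *\<^sub>v u (j + 1) - \<beta> (j + 1) \<cdot>\<^sub>v v j)"

definition gkb ::
  "real mat \<Rightarrow> real vec \<Rightarrow> nat \<Rightarrow>
   (nat \<Rightarrow> real) \<Rightarrow> (nat \<Rightarrow> real) \<Rightarrow> (nat \<Rightarrow> real vec) \<Rightarrow> (nat \<Rightarrow> real vec) \<Rightarrow> bool" where
  "gkb A b = bidiag_recurrence A (transpose_mat A) b"

definition normalized_complement :: "real mat \<Rightarrow> real vec \<Rightarrow> real vec" where
  "normalized_complement W x =
     (let y = x - W *\<^sub>v (transpose_mat W *\<^sub>v x) in (1 / vnorm y) \<cdot>\<^sub>v y)"

text \<open>The QR factors are not unique; no sign or rank convention on \<open>R\<close> is imposed.\<close>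

definition skinny_QR :: "real mat \<Rightarrow> real mat \<Rightarrow> real mat \<Rightarrow> bool" where
  "skinny_QR C Y R \<longleftrightarrow>
     Y \<in> carrier_mat (dim_row C) (dim_col C) \<and> orthonormal_cols Y \<and>
     R \<in> carrier_mat (dim_col C) (dim_col C) \<and> upper_triangular R \<and> C = Y * R"

text \<open>
  \<open>l\<close> steps of recycling GKB, from \<open>W'\<close> (the previous recycling basis) and the approximate solution
  \<open>x\<close>. The left step uses the projected matrix \<open>P * A\<close>, the right step the unprojected transpose
  of \<open>A\<close>.
\<close>

definition recycling_gkb ::
  "real mat \<Rightarrow> real vec \<Rightarrow> real mat \<Rightarrow> real vec \<Rightarrow> nat \<Rightarrow> real mat \<Rightarrow> real mat \<Rightarrow> real mat \<Rightarrow>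
   (nat \<Rightarrow> real) \<Rightarrow> (nat \<Rightarrow> real) \<Rightarrow> (nat \<Rightarrow> real vec) \<Rightarrow> (nat \<Rightarrow> real vec) \<Rightarrow> bool" where
  "recycling_gkb A b W' x l W Y R \<alpha> \<beta> u v \<longleftrightarrow>
     (let xc = normalized_complement W' x;
          P = 1\<^sub>m (dim_row A) - Y * transpose_mat Y
      in W = W' @\<^sub>c mat_of_cols (dim_col A) [xc] \<and>
         skinny_QR (A * W) Y R \<and>
         bidiag_recurrence (P * A) (transpose_mat A) (P *\<^sub>v (b - A *\<^sub>v xc)) l \<alpha> \<beta> u v)"

end

theory Submission
  imports Defs
begin

text \<open>
  Both bidiagonalizations satisfy a matrix relation: \<open>A * V = U * B\<close> for the standard process and
  \<open>(1 - Y * Y\<^sup>T) * A * V' = U' * B'\<close> for the recycling one (\<open>bidiag_recurrence_matrix_relation\<close>).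
  Substituting \<open>W = V * Z1\<close>, \<open>V' = V * Z2\<close>, \<open>Y = U * T1\<close> and \<open>U' = U * T2\<close> into \<open>A * W = Y * R\<close> and
  into the second relation gives
  \<open>U * (B * Z1) = U * (T1 * R)\<close> and \<open>U * (B * Z2) = U * (T2 * B' + T1 * (Y\<^sup>T * A * V'))\<close>.

  Golub-Kahan vectors are orthonormal (\<open>gkb_orthonormal_left\<close>), so \<open>U\<close> has a left inverse and
  cancels:
  \<open>B * Z1 = T1 * R\<close> and \<open>B * Z2 = T2 * B' + T1 * (Y\<^sup>T * A * V')\<close>.
  Multiplying these from the left by \<open>T1\<^sup>T\<close>, \<open>T2\<^sup>T\<close> and \<open>Tc\<^sup>T\<close>, whose mutual products are read off
  from the orthogonality of \<open>[T1 T2 Tc]\<close> (\<open>orthonormal_cols_append_colsD\<close>), produces the first two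
  block columns; the third is the definition of block multiplication.
\<close>

section \<open>Column blocks\<close>

lemma append_cols_carrier:
  assumes "P \<in> carrier_mat n p" "Q \<in> carrier_mat n q"
  shows "P @\<^sub>c Q \<in> carrier_mat n (p + q)"
  using four_block_carrier_mat[OF assms(1) zero_carrier_mat[of 0 q], of Q "0\<^sub>m 0 p"] assms
  unfolding append_cols_def by simp

lemma index_append_cols:
  assumes "P \<in> carrier_mat n p" "Q \<in> carrier_mat n q" "i < n" "j < p + q"
  shows "(P @\<^sub>c Q) $$ (i, j) = (if j < p then P $$ (i, j) else Q $$ (i, j - p))"
  using assms by (auto simp: append_cols_def)

lemma col_append_cols:
  assumes "P \<in> carrier_mat n p" "Q \<in> carrier_mat n q" "j < p + q"
  shows "col (P @\<^sub>c Q) j = (if j < p then col P j else col Q (j - p))"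
  using assms append_cols_carrier[OF assms(1,2)]
  by (intro eq_vecI) (auto simp: index_append_cols[OF assms(1,2)])

lemma mult_append_cols:
  fixes X P Q :: "'a :: semiring_0 mat"
  assumes X: "X \<in> carrier_mat r n" and P: "P \<in> carrier_mat n p" and Q: "Q \<in> carrier_mat n q"
  shows "X * (P @\<^sub>c Q) = X * P @\<^sub>c X * Q"
proof -
  have c: "X * P \<in> carrier_mat r p" "X * Q \<in> carrier_mat r q"
    using assms by auto
  note PQ = append_cols_carrier[OF P Q] and XPQ = append_cols_carrier[OF c]
  show ?thesis
  proof (rule eq_matI)
    fix i j assume "i < dim_row (X * P @\<^sub>c X * Q)" "j < dim_col (X * P @\<^sub>c X * Q)"
    then have ij: "i < r" "j < p + q" using XPQ by auto
    then show "(X * (P @\<^sub>c Q)) $$ (i, j) = (X * P @\<^sub>c X * Q) $$ (i, j)"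
      using X P Q PQ by (simp add: index_append_cols[OF c ij] col_append_cols[OF P Q ij(2)])
  qed (use X PQ XPQ in auto)
qed

lemma transpose_append_cols:
  assumes "P \<in> carrier_mat n p" "Q \<in> carrier_mat n q"
  shows "transpose_mat (P @\<^sub>c Q) = transpose_mat P @\<^sub>r transpose_mat Q"
  using assms transpose_four_block_mat[OF assms zero_carrier_mat zero_carrier_mat]
  by (simp add: append_cols_def append_rows_def)

lemma append_rows_mult:
  fixes X P Q :: "'a :: semiring_0 mat"
  assumes P: "P \<in> carrier_mat p n" and Q: "Q \<in> carrier_mat q n" and X: "X \<in> carrier_mat n r"
  shows "(P @\<^sub>r Q) * X = P * X @\<^sub>r Q * X"
proof -
  have c: "P * X \<in> carrier_mat p r" "Q * X \<in> carrier_mat q r" using assms by auto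
  note PQ = carrier_append_rows[OF P Q] and PQX = carrier_append_rows[OF c]
  have row: "row (P @\<^sub>r Q) i = (if i < p then row P i else row Q (i - p))" if "i < p + q" for i
    using P Q PQ that by (intro eq_vecI) (auto simp: append_rows_def)
  show ?thesis
  proof (rule eq_matI)
    fix i j assume "i < dim_row (P * X @\<^sub>r Q * X)" "j < dim_col (P * X @\<^sub>r Q * X)"
    then have ij: "i < p + q" "j < r" using PQX by auto
    then have "(P * X @\<^sub>r Q * X) $$ (i, j) =
        (if i < p then (P * X) $$ (i, j) else (Q * X) $$ (i - p, j))"
      using P Q X c by (auto simp: append_rows_def simp del: index_mult_mat(1))
    then show "((P @\<^sub>r Q) * X) $$ (i, j) = (P * X @\<^sub>r Q * X) $$ (i, j)"
      using P Q X carrier_matD[OF PQ] ij by (simp add: row)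
  qed (use X carrier_matD[OF PQ] carrier_matD[OF PQX] in auto)
qed

section \<open>Orthonormal columns\<close>

lemma orthonormal_cols_iff:
  "orthonormal_cols Q \<longleftrightarrow>
     (\<forall>i<dim_col Q. \<forall>j<dim_col Q. col Q i \<bullet> col Q j = (if i = j then 1 else 0))"
proof -
  have "(transpose_mat Q * Q) $$ (i, j) = col Q i \<bullet> col Q j"
    if "i < dim_col Q" "j < dim_col Q" for i j
    using that by simp
  then show ?thesis
    unfolding orthonormal_cols_def
    by (auto simp: mat_eq_iff)
qed

lemma real_orthogonal_imp_orthonormal_cols:
  "real_orthogonal Q \<Longrightarrow> orthonormal_cols Q"
  unfolding real_orthogonal_def orthonormal_cols_def by simp

text \<open>The Gram matrix of \<open>[P Q]\<close> has the Gram matrices of \<open>P\<close> and \<open>Q\<close> as diagonal blocks, and it is the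
  identity.\<close>

lemma orthonormal_cols_append_colsD:
  assumes P: "P \<in> carrier_mat n p" and Q: "Q \<in> carrier_mat n q"
    and on: "orthonormal_cols (P @\<^sub>c Q)"
  shows "orthonormal_cols P" "orthonormal_cols Q"
    "transpose_mat P * Q = 0\<^sub>m p q" "transpose_mat Q * P = 0\<^sub>m q p"
proof -
  note c = append_cols_carrier[OF P Q]
  have ip: "col (P @\<^sub>c Q) i \<bullet> col (P @\<^sub>c Q) j = (if i = j then 1 else 0)"
    if "i < p + q" "j < p + q" for i j
    using on that c unfolding orthonormal_cols_iff by auto
  have PP: "col P i \<bullet> col P j = (if i = j then 1 else 0)" if "i < p" "j < p" for i j
    using ip[of i j] that by (simp add: col_append_cols[OF P Q])
  have QQ: "col Q i \<bullet> col Q j = (if i = j then 1 else 0)" if "i < q" "j < q" for i j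
    using ip[of "p + i" "p + j"] that by (simp add: col_append_cols[OF P Q])
  have PQ: "col P i \<bullet> col Q j = 0" if "i < p" "j < q" for i j
    using ip[of i "p + j"] that by (simp add: col_append_cols[OF P Q])
  have QP: "col Q i \<bullet> col P j = 0" if "i < q" "j < p" for i j
    using ip[of "p + i" j] that by (simp add: col_append_cols[OF P Q])
  show "orthonormal_cols P" "orthonormal_cols Q"
    using PP QQ P Q by (auto simp: orthonormal_cols_iff)
  show "transpose_mat P * Q = 0\<^sub>m p q" "transpose_mat Q * P = 0\<^sub>m q p"
    using PQ QP P Q by (auto intro!: eq_matI)
qed

lemma mult_append_cols_eq_zeroD:
  fixes X P Q :: "'a :: semiring_0 mat"
  assumes X: "X \<in> carrier_mat r n" and P: "P \<in> carrier_mat n p" and Q: "Q \<in> carrier_mat n q"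
    and zero: "X * (P @\<^sub>c Q) = 0\<^sub>m r (p + q)"
  shows "X * P = 0\<^sub>m r p" "X * Q = 0\<^sub>m r q"
proof -
  note c = append_cols_carrier[OF P Q]
  have ip: "row X i \<bullet> col (P @\<^sub>c Q) j = 0" if "i < r" "j < p + q" for i j
    using arg_cong[OF zero, of "\<lambda>Z. Z $$ (i, j)"] that X c by simp
  have "row X i \<bullet> col P j = 0" if "i < r" "j < p" for i j
    using ip[of i j] that by (simp add: col_append_cols[OF P Q])
  moreover have "row X i \<bullet> col Q j = 0" if "i < r" "j < q" for i j
    using ip[of i "p + j"] that by (simp add: col_append_cols[OF P Q])
  ultimately show "X * P = 0\<^sub>m r p" "X * Q = 0\<^sub>m r q"
    using X P Q by (auto intro!: eq_matI)
qed

lemma orthonormal_cols_mult_left_cancel: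
  assumes "orthonormal_cols Q" "Q \<in> carrier_mat r n" "X \<in> carrier_mat n c" "X' \<in> carrier_mat n c"
    and "Q * X = Q * X'"
  shows "X = X'"
proof -
  have "transpose_mat Q * (Q * X) = X" if "X \<in> carrier_mat n c" for X
  proof -
    have "transpose_mat Q * (Q * X) = (transpose_mat Q * Q) * X"
      using assms(2) that by (intro assoc_mult_mat[symmetric]) auto
    then show ?thesis using assms(1,2) that by (simp add: orthonormal_cols_def del: assoc_mult_mat)
  qed
  then show ?thesis using assms by metis
qed

section \<open>The bidiagonalization recurrence\<close>

lemma cols_upto_carrier: "cols_upto d v n \<in> carrier_mat d n"
  unfolding cols_upto_def by (intro carrier_matI) (simp_all del: upt_Suc)

lemma dim_cols_upto [simp]: "dim_row (cols_upto d v n) = d" "dim_col (cols_upto d v n) = n"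
  using cols_upto_carrier[of d v n] by auto

lemma col_cols_upto:
  assumes "j < n" "v (Suc j) \<in> carrier_vec d"
  shows "col (cols_upto d v n) j = v (Suc j)"
  using assms unfolding cols_upto_def
  by (subst col_mat_of_cols) (auto simp del: upt_Suc)

lemma lower_bidiagonal_carrier: "lower_bidiagonal n \<alpha> \<beta> \<in> carrier_mat (n + 1) n"
  unfolding lower_bidiagonal_def by simp

text \<open>
  Column \<open>j\<close> of the product \<open>U * B\<close> only sees the two nonzero entries of column \<open>j\<close> of \<open>B\<close>, so it is
  the right-hand side of \<open>C * v j = \<alpha> j * u j + \<beta> (j + 1) * u (j + 1)\<close>. This is only the left step of the
  recurrence, so the relation holds for any pair \<open>C\<close>, \<open>D\<close>, in particular when \<open>C\<close> is the projected
  matrix and \<open>D\<close> the unprojected transpose.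
\<close>

lemma bidiag_recurrence_matrix_relation:
  assumes rec: "bidiag_recurrence C D s n \<alpha> \<beta> u v" and C: "C \<in> carrier_mat M N"
  shows "C * cols_upto N v n = cols_upto M u (n + 1) * lower_bidiagonal n \<alpha> \<beta>"
proof (rule eq_matI)
  fix i j
  assume "i < dim_row (cols_upto M u (n + 1) * lower_bidiagonal n \<alpha> \<beta>)"
    and "j < dim_col (cols_upto M u (n + 1) * lower_bidiagonal n \<alpha> \<beta>)"
  then have i: "i < M" and j: "j < n" by (auto simp: lower_bidiagonal_def)
  have u: "u p \<in> carrier_vec M" if "1 \<le> p" "p \<le> n + 1" for p
    using rec C that unfolding bidiag_recurrence_def by auto
  have v: "v p \<in> carrier_vec N" if "1 \<le> p" "p \<le> n" for p
    using rec C that unfolding bidiag_recurrence_def by auto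
  have step: "\<beta> (j + 2) \<cdot>\<^sub>v u (j + 2) = C *\<^sub>v v (j + 1) - \<alpha> (j + 1) \<cdot>\<^sub>v u (j + 1)"
    using rec j unfolding bidiag_recurrence_def by force
  have U_entry: "cols_upto M u (n + 1) $$ (i, p) = u (p + 1) $ i" if "p < n + 1" for p
    using col_cols_upto[of p "n + 1" u M] u[of "p + 1"] that i
      index_col[of i "cols_upto M u (n + 1)" p] by simp
  have "(cols_upto M u (n + 1) * lower_bidiagonal n \<alpha> \<beta>) $$ (i, j) =
      (\<Sum>p<n + 1. u (p + 1) $ i *
        (if p = j then \<alpha> (j + 1) else if p = j + 1 then \<beta> (j + 2) else 0))"
    using i j U_entry
    by (auto simp: scalar_prod_def lower_bidiagonal_def atLeast0LessThan intro!: sum.cong)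
  also have "\<dots> = (\<Sum>p\<in>{j, j + 1}. u (p + 1) $ i *
        (if p = j then \<alpha> (j + 1) else if p = j + 1 then \<beta> (j + 2) else 0))"
    using j by (intro sum.mono_neutral_right) auto
  also have "\<dots> = u (j + 1) $ i * \<alpha> (j + 1) + u (j + 2) $ i * \<beta> (j + 2)" by simp
  also have "\<dots> = (C *\<^sub>v v (j + 1)) $ i"
    using arg_cong[OF step, of "\<lambda>w. w $ i"] u[of "j + 1"] u[of "j + 2"] i j C
    by (simp add: algebra_simps)
  also have "\<dots> = (C * cols_upto N v n) $$ (i, j)"
    using i j C v[of "j + 1"] by (simp add: col_cols_upto)
  finally show "(C * cols_upto N v n) $$ (i, j) =
      (cols_upto M u (n + 1) * lower_bidiagonal n \<alpha> \<beta>) $$ (i, j)" ..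
qed (use C in \<open>auto simp: lower_bidiagonal_def\<close>)

text \<open>
  Each new vector is orthogonal to the earlier ones of its own side because \<open>A\<close> and its transpose
  move the inner product to the other side, where the recurrence expresses the result by two
  neighbouring vectors that are already known to be orthonormal; for the immediate predecessor the
  subtracted term cancels the remaining coefficient. The two sides therefore have to be proved
  orthonormal together, alternating between them. The bound \<open>min J n\<close> reflects that \<open>n\<close> steps produce
  \<open>n + 1\<close> left but only \<open>n\<close> right vectors.
\<close>

lemma gkb_orthonormal_both:
  assumes A: "A \<in> carrier_mat M N" and gkb: "gkb A b n \<alpha> \<beta> u v"
  shows "J \<le> n + 1 \<Longrightarrow>
    (\<forall>i\<in>{1..J}. \<forall>j\<in>{1..J}. u i \<bullet> u j = (if i = j then 1 else 0)) \<and>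
    (\<forall>i\<in>{1..min J n}. \<forall>j\<in>{1..min J n}. v i \<bullet> v j = (if i = j then 1 else 0))"
proof -
  have u: "u j \<in> carrier_vec M" "u j \<bullet> u j = 1" "\<beta> j > 0" if "1 \<le> j" "j \<le> n + 1" for j
    using gkb A that unfolding gkb_def bidiag_recurrence_def vnorm_def by auto
  have v: "v j \<in> carrier_vec N" "v j \<bullet> v j = 1" "\<alpha> j > 0" if "1 \<le> j" "j \<le> n" for j
    using gkb A that unfolding gkb_def bidiag_recurrence_def vnorm_def by auto
  note commU = comm_scalar_prod[of _ M] and commV = comm_scalar_prod[of _ N]
  have adj: "p \<bullet> (A *\<^sub>v q) = (transpose_mat A *\<^sub>v p) \<bullet> q"
    if "p \<in> carrier_vec M" "q \<in> carrier_vec N" for p q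
    using transpose_vec_mult_scalar[OF A that(2,1)] that A commU commV by simp
  have first: "\<alpha> 1 * (v 1 \<bullet> w) = (transpose_mat A *\<^sub>v u 1) \<bullet> w"
    if "w \<in> carrier_vec N" "1 \<le> n" for w
  proof -
    have "\<alpha> 1 \<cdot>\<^sub>v v 1 = transpose_mat A *\<^sub>v u 1"
      using gkb unfolding gkb_def bidiag_recurrence_def by auto
    then show ?thesis using that v[of 1] by (metis smult_scalar_prod_distrib order_refl)
  qed
  have left: "\<beta> (j + 1) * (w \<bullet> u (j + 1)) = w \<bullet> (A *\<^sub>v v j) - \<alpha> j * (w \<bullet> u j)"
    if "w \<in> carrier_vec M" "1 \<le> j" "j \<le> n" for w j
  proof -
    have "\<beta> (j + 1) \<cdot>\<^sub>v u (j + 1) = A *\<^sub>v v j - \<alpha> j \<cdot>\<^sub>v u j"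
      using gkb that unfolding gkb_def bidiag_recurrence_def by auto
    then have "w \<bullet> (\<beta> (j + 1) \<cdot>\<^sub>v u (j + 1)) = w \<bullet> (A *\<^sub>v v j - \<alpha> j \<cdot>\<^sub>v u j)" by simp
    then show ?thesis
      using that u[of "j + 1"] u[of j] v[of j] A by (simp add: scalar_prod_minus_distrib[of _ M])
  qed
  have right: "\<alpha> (j + 1) * (v (j + 1) \<bullet> w) =
      (transpose_mat A *\<^sub>v u (j + 1)) \<bullet> w - \<beta> (j + 1) * (v j \<bullet> w)"
    if "w \<in> carrier_vec N" "1 \<le> j" "j < n" for w j
  proof -
    have "\<alpha> (j + 1) \<cdot>\<^sub>v v (j + 1) = transpose_mat A *\<^sub>v u (j + 1) - \<beta> (j + 1) \<cdot>\<^sub>v v j"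
      using gkb that unfolding gkb_def bidiag_recurrence_def by auto
    then have "(\<alpha> (j + 1) \<cdot>\<^sub>v v (j + 1)) \<bullet> w =
        (transpose_mat A *\<^sub>v u (j + 1) - \<beta> (j + 1) \<cdot>\<^sub>v v j) \<bullet> w" by simp
    then show ?thesis
      using that u[of "j + 1"] v[of "j + 1"] v[of j] A by (simp add: minus_scalar_prod_distrib[of _ N])
  qed
  show "J \<le> n + 1 \<Longrightarrow> ?thesis"
  proof (induction J)
    case 0
    then show ?case by simp
  next
    case (Suc J)
    then have J: "J \<le> n"
      and uu: "\<And>i j. 1 \<le> i \<Longrightarrow> i \<le> J \<Longrightarrow> 1 \<le> j \<Longrightarrow> j \<le> J \<Longrightarrow> u i \<bullet> u j = (if i = j then 1 else 0)"
      and vv: "\<And>i j. 1 \<le> i \<Longrightarrow> i \<le> J \<Longrightarrow> 1 \<le> j \<Longrightarrow> j \<le> J \<Longrightarrow> v i \<bullet> v j = (if i = j then 1 else 0)"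
      by auto
    have u_new: "u i \<bullet> u (J + 1) = 0" if i: "1 \<le> i" "i \<le> J" for i
    proof -
      have "u i \<bullet> (A *\<^sub>v v J) = \<alpha> J * (u i \<bullet> u J)"
      proof (cases "i = 1")
        \<comment> \<open>The starting relation for \<open>v 1\<close> lacks the subtracted term, so it is treated apart.\<close>
        case True
        then show ?thesis
          using adj[of "u 1" "v J"] first[of "v J"] uu[of 1 J] vv[of 1 J] u[of 1] v[of J] i J by auto
      next
        case False
        then obtain h where "i = h + 1" "1 \<le> h"
          using i(1) by (metis add.commute le_antisym le_add_diff_inverse not_less_eq_eq plus_1_eq_Suc)
        then show ?thesis
          using adj[of "u i" "v J"] right[of "v J" h] uu[of i J] vv[of i J] vv[of h J] u[of i] v[of J] i J
          by (auto split: if_splits)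
      qed
      then have "\<beta> (J + 1) * (u i \<bullet> u (J + 1)) = 0"
        using left[of "u i" J] u[of i] i J by simp
      then show ?thesis using u(3)[of "J + 1"] J by simp
    qed
    have uu': "u i \<bullet> u j = (if i = j then 1 else 0)"
      if "1 \<le> i" "i \<le> J + 1" "1 \<le> j" "j \<le> J + 1" for i j
      using that uu[of i j] u_new[of i] u_new[of j] u(2)[of i] u(1)[of i] u(1)[of j] J
        commU[of "u i" "u j"]
      by (cases "i = J + 1"; cases "j = J + 1") auto
    have v_new: "v (J + 1) \<bullet> v i = 0" if i: "1 \<le> i" "i \<le> J" and J': "J < n" for i
    proof -
      have "u (J + 1) \<bullet> (A *\<^sub>v v i) = \<beta> (J + 1) * (v J \<bullet> v i)"
        using left[of "u (J + 1)" i] uu'[of "J + 1" "i + 1"] uu'[of "J + 1" i] vv[of J i]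
          u[of "J + 1"] i J by (auto split: if_splits)
      then have "\<alpha> (J + 1) * (v (J + 1) \<bullet> v i) = 0"
        using right[of "v i" J] adj[of "u (J + 1)" "v i"] u[of "J + 1"] v[of i] i J' by simp
      then show ?thesis using v(3)[of "J + 1"] J' by simp
    qed
    have vv': "v i \<bullet> v j = (if i = j then 1 else 0)"
      if "1 \<le> i" "i \<le> min (J + 1) n" "1 \<le> j" "j \<le> min (J + 1) n" for i j
      using that vv[of i j] v_new[of i] v_new[of j] v(2)[of i] v(1)[of i] v(1)[of j]
        commV[of "v i" "v j"]
      by (cases "i = J + 1"; cases "j = J + 1") auto
    show ?case using uu' vv' by simp
  qed
qed

lemma gkb_orthonormal_left:
  assumes A: "A \<in> carrier_mat M N" and gkb: "gkb A b n \<alpha> \<beta> u v"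
  shows "orthonormal_cols (cols_upto M u (n + 1))"
proof -
  have "u j \<in> carrier_vec M" if "1 \<le> j" "j \<le> n + 1" for j
    using gkb A that unfolding gkb_def bidiag_recurrence_def by auto
  then show ?thesis
    using gkb_orthonormal_both[OF A gkb, of "n + 1"]
    by (auto simp: orthonormal_cols_iff col_cols_upto)
qed

section \<open>The block form of the transformed bidiagonal matrix\<close>

theorem lemma3p3:
  fixes A W' W Y R T1 T2 Tc Z1 Z2 Zc U V B U' V' B' :: "real mat"
    and b x :: "real vec"
    and M N m k l :: nat
    and \<alpha> \<beta> \<alpha>' \<beta>' :: "nat \<Rightarrow> real"
    and u v u' v' :: "nat \<Rightarrow> real vec"
  assumes A: "A \<in> carrier_mat M N" and b: "b \<in> carrier_vec M"
    and l: "1 \<le> l" and k: "1 \<le> k" "k \<le> m"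
    and gkb: "gkb A b (m + l) \<alpha> \<beta> u v"
    and V: "V = cols_upto N v (m + l)"
    and U: "U = cols_upto M u (m + l + 1)"
    and B: "B = lower_bidiagonal (m + l) \<alpha> \<beta>"
    and W': "W' \<in> carrier_mat N (k - 1)" "orthonormal_cols W'"
      "vec_space.col_space N W' \<subseteq> vec_space.col_space N (cols_upto N v m)"
    and x: "x \<in> vec_space.col_space N (cols_upto N v m)" "x \<notin> vec_space.col_space N W'"
    and rec: "recycling_gkb A b W' x l W Y R \<alpha>' \<beta>' u' v'"
    and V': "V' = cols_upto N v' l"
    and U': "U' = cols_upto M u' (l + 1)"
    and B': "B' = lower_bidiagonal l \<alpha>' \<beta>'"
    and T: "T1 \<in> carrier_mat (m + l + 1) k" "T2 \<in> carrier_mat (m + l + 1) (l + 1)"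
      "Tc \<in> carrier_mat (m + l + 1) (m - k)" "real_orthogonal (T1 @\<^sub>c T2 @\<^sub>c Tc)"
    and Z: "Z1 \<in> carrier_mat (m + l) k" "Z2 \<in> carrier_mat (m + l) l"
      "Zc \<in> carrier_mat (m + l) (m - k)" "real_orthogonal (Z1 @\<^sub>c Z2 @\<^sub>c Zc)"
    and YT: "Y = U * T1" and UT: "U' = U * T2"
    and WZ: "W = V * Z1" and VZ: "V' = V * Z2"
  shows "transpose_mat (T1 @\<^sub>c T2 @\<^sub>c Tc) * B * (Z1 @\<^sub>c Z2 @\<^sub>c Zc) =
      (R                  @\<^sub>c transpose_mat Y * A * V' @\<^sub>c transpose_mat T1 * B * Zc)
   @\<^sub>r (0\<^sub>m (l + 1) k      @\<^sub>c B'                       @\<^sub>c transpose_mat T2 * B * Zc)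
   @\<^sub>r (0\<^sub>m (m - k) k      @\<^sub>c 0\<^sub>m (m - k) l             @\<^sub>c transpose_mat Tc * B * Zc)"
proof -
  define G where "G = transpose_mat Y * A * V'"
  let ?P = "1\<^sub>m M - Y * transpose_mat Y"
  have carrU: "U \<in> carrier_mat M (m + l + 1)" and carrV: "V \<in> carrier_mat N (m + l)"
    and carrB: "B \<in> carrier_mat (m + l + 1) (m + l)"
    and carrU': "U' \<in> carrier_mat M (l + 1)" and carrV': "V' \<in> carrier_mat N l"
    and carrB': "B' \<in> carrier_mat (l + 1) l"
    unfolding U V B U' V' B' by (rule cols_upto_carrier lower_bidiagonal_carrier)+
  have carrW: "W \<in> carrier_mat N k" using WZ carrV Z(1) by simp
  have carrY: "Y \<in> carrier_mat M k" using YT carrU T(1) by simp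
  have QR: "R \<in> carrier_mat k k" "A * W = Y * R"
    using rec A carrW unfolding recycling_gkb_def Let_def skinny_QR_def by auto
  have carrG: "G \<in> carrier_mat k l" using carrY A carrV' unfolding G_def by auto
  have carrAV': "A * V' \<in> carrier_mat M l" using A carrV' by simp

  have AV: "A * V = U * B"
    using bidiag_recurrence_matrix_relation[of A _ _ "m + l" \<alpha> \<beta> u v, OF _ A] gkb
    unfolding gkb_def U V B by blast
  have "bidiag_recurrence (?P * A) (transpose_mat A)
      (?P *\<^sub>v (b - A *\<^sub>v normalized_complement W' x)) l \<alpha>' \<beta>' u' v'"
    using rec A unfolding recycling_gkb_def Let_def by auto
  then have PAV': "?P * A * V' = U' * B'"
    unfolding U' V' B'
    by (rule bidiag_recurrence_matrix_relation) (use carrY A in auto)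
  \<comment> \<open>The component of \<open>A * V'\<close> removed by the projection is \<open>Y * G\<close>; adding it back is what makes \<open>G\<close>
    appear as the block above \<open>B'\<close>.\<close>
  have AV': "A * V' = U' * B' + Y * G"
  proof -
    have "?P * A * V' = A * V' - Y * G"
    proof -
      have "?P * A * V' = ?P * (A * V')"
        using carrY A carrV' by (intro assoc_mult_mat[of _ M M _ N _ l]) auto
      also have "\<dots> = A * V' - Y * transpose_mat Y * (A * V')"
        using carrY carrAV' left_mult_one_mat[OF carrAV']
        by (simp add: minus_mult_distrib_mat[of _ M M _ _ l])
      also have "Y * transpose_mat Y * (A * V') = Y * G"
        using carrY carrAV' A carrV' unfolding G_def
        by (simp add: assoc_mult_mat[of _ M k _ M _ l])
      finally show ?thesis .
    qed
    moreover have "A * V' = (A * V' - Y * G) + Y * G"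
      using carrAV' carrY carrG by (intro eq_matI) (auto simp del: index_mult_mat(1))
    ultimately show ?thesis using PAV' by simp
  qed

  have onU: "orthonormal_cols U"
    unfolding U by (rule gkb_orthonormal_left[OF A gkb])
  have BZ1: "B * Z1 = T1 * R"
  proof (rule orthonormal_cols_mult_left_cancel[OF onU carrU])
    have "U * (B * Z1) = A * V * Z1"
      unfolding AV using carrU carrB Z(1) by simp
    also have "\<dots> = A * W"
      unfolding WZ using A carrV Z(1) by simp
    also have "\<dots> = U * (T1 * R)"
      unfolding QR(2) YT using carrU T(1) QR(1) by simp
    finally show "U * (B * Z1) = U * (T1 * R)" .
  qed (use carrB Z(1) T(1) QR in auto)
  have BZ2: "B * Z2 = T2 * B' + T1 * G"
  proof (rule orthonormal_cols_mult_left_cancel[OF onU carrU])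
    have "U * (B * Z2) = A * V * Z2"
      unfolding AV using carrU carrB Z(2) by simp
    also have "\<dots> = A * V'"
      unfolding VZ using A carrV Z(2) by simp
    also have "\<dots> = U * T2 * B' + U * T1 * G" using AV' UT YT by simp
    also have "\<dots> = U * (T2 * B' + T1 * G)"
      using carrU T carrB' carrG
      by (simp add: mult_add_distrib_mat[of _ M "m + l + 1" _ l])
    finally show "U * (B * Z2) = U * (T2 * B' + T1 * G)" .
  qed (use carrB carrB' Z(2) T carrG in auto)

  note T2c = append_cols_carrier[OF T(2,3)] and Z2c = append_cols_carrier[OF Z(2,3)]
  note onT = orthonormal_cols_append_colsD[OF T(1) T2c real_orthogonal_imp_orthonormal_cols[OF T(4)]]
  note onT2c = orthonormal_cols_append_colsD[OF T(2,3) onT(2)]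
  have norm: "transpose_mat T1 * T1 = 1\<^sub>m k" "transpose_mat T2 * T2 = 1\<^sub>m (l + 1)"
    using onT(1) onT2c(1) T unfolding orthonormal_cols_def by auto
  have T1t: "transpose_mat T1 \<in> carrier_mat k (m + l + 1)" using T(1) by simp
  note T1_T2c = mult_append_cols_eq_zeroD[OF T1t T(2,3) onT(3)]
  have T21: "transpose_mat T2 * T1 = 0\<^sub>m (l + 1) k"
    using arg_cong[OF T1_T2c(1), of transpose_mat] T1t T by (simp add: transpose_mult)
  have Tc1: "transpose_mat Tc * T1 = 0\<^sub>m (m - k) k"
    using arg_cong[OF T1_T2c(2), of transpose_mat] T1t T by (simp add: transpose_mult)
  note prods = norm T1_T2c(1) T21 Tc1 onT2c(4)

  have blk1: "transpose_mat X * B * Z1 = transpose_mat X * T1 * R"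
    if "X \<in> carrier_mat (m + l + 1) q" for X q
  proof -
    have "transpose_mat X * B * Z1 = transpose_mat X * (B * Z1)"
      using that carrB Z(1) by (intro assoc_mult_mat) auto
    then show ?thesis using that T(1) QR(1) by (simp add: BZ1)
  qed
  have blk2: "transpose_mat X * B * Z2 = transpose_mat X * T2 * B' + transpose_mat X * T1 * G"
    if "X \<in> carrier_mat (m + l + 1) q" for X q
  proof -
    have "transpose_mat X * B * Z2 = transpose_mat X * (B * Z2)"
      using that carrB Z(2) by (intro assoc_mult_mat) auto
    also have "\<dots> = transpose_mat X * (T2 * B') + transpose_mat X * (T1 * G)"
      unfolding BZ2 using that T carrB' carrG by (intro mult_add_distrib_mat) auto
    finally show ?thesis using that T carrB' carrG by simp
  qed
  have row_split: "transpose_mat X * B * (Z1 @\<^sub>c Z2 @\<^sub>c Zc) =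
      transpose_mat X * B * Z1 @\<^sub>c transpose_mat X * B * Z2 @\<^sub>c transpose_mat X * B * Zc"
    if "X \<in> carrier_mat (m + l + 1) q" for X q
  proof -
    have "transpose_mat X * B \<in> carrier_mat q (m + l)" using that carrB by simp
    then show ?thesis
      using mult_append_cols[OF _ Z(1) Z2c] mult_append_cols[OF _ Z(2,3)] by simp
  qed
  have "transpose_mat (T1 @\<^sub>c T2 @\<^sub>c Tc) * B * (Z1 @\<^sub>c Z2 @\<^sub>c Zc) =
      transpose_mat T1 * B * (Z1 @\<^sub>c Z2 @\<^sub>c Zc) @\<^sub>r transpose_mat T2 * B * (Z1 @\<^sub>c Z2 @\<^sub>c Zc)
      @\<^sub>r transpose_mat Tc * B * (Z1 @\<^sub>c Z2 @\<^sub>c Zc)"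
  proof -
    have t: "transpose_mat T1 \<in> carrier_mat k (m + l + 1)"
      "transpose_mat T2 \<in> carrier_mat (l + 1) (m + l + 1)"
      "transpose_mat Tc \<in> carrier_mat (m - k) (m + l + 1)"
      using T by auto
    note tB = mult_carrier_mat[OF t(1) carrB] mult_carrier_mat[OF t(2) carrB]
      mult_carrier_mat[OF t(3) carrB]
    note Zcarr = append_cols_carrier[OF Z(1) Z2c]
    show ?thesis
      unfolding transpose_append_cols[OF T(1) T2c] transpose_append_cols[OF T(2,3)]
        append_rows_mult[OF t(1) carrier_append_rows[OF t(2,3)] carrB]
        append_rows_mult[OF t(2,3) carrB]
        append_rows_mult[OF tB(1) carrier_append_rows[OF tB(2,3)] Zcarr]
        append_rows_mult[OF tB(2,3) Zcarr] ..
  qed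
  also have "transpose_mat T1 * B * (Z1 @\<^sub>c Z2 @\<^sub>c Zc) = R @\<^sub>c G @\<^sub>c transpose_mat T1 * B * Zc"
    using QR(1) carrG carrB' by (simp add: row_split[OF T(1)] blk1[OF T(1)] blk2[OF T(1)] prods)
  also have "transpose_mat T2 * B * (Z1 @\<^sub>c Z2 @\<^sub>c Zc) =
      0\<^sub>m (l + 1) k @\<^sub>c B' @\<^sub>c transpose_mat T2 * B * Zc"
    using QR(1) carrG carrB' by (simp add: row_split[OF T(2)] blk1[OF T(2)] blk2[OF T(2)] prods)
  also have "transpose_mat Tc * B * (Z1 @\<^sub>c Z2 @\<^sub>c Zc) =
      0\<^sub>m (m - k) k @\<^sub>c 0\<^sub>m (m - k) l @\<^sub>c transpose_mat Tc * B * Zc"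
    using QR(1) carrG carrB' by (simp add: row_split[OF T(3)] blk1[OF T(3)] blk2[OF T(3)] prods)
  finally show ?thesis unfolding G_def .
qed

end
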